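(* Let $n\ge 2$ be an integer and consider $\mathbb{R}^{n}$ with coordinates $(t_1,\dots,t_{n-1},t_x)$, restricted to $t_x\le 0$. Let $\alpha_{ii}(t_1,\dots,t_{n-1},t_x)$, $1\le i\le n$, be the headlight functions of the tadpole curves $C_{ii}$ of the $n$-point one-loop planar tadpole reference fat graph (defined in the context), and let $$\mathcal{M}^{\mathrm{tf}}_{1,n}=\{(t_1,\dots,t_{n-1},t_x)\in\mathbb{R}^n:\ t_x\le 0,\ \alpha_{ii}(t_1,\dots,t_{n-1},t_x)=0\ \text{ for all } 1\le i\le n\}.$$ For $1\le I\le n-1$ let $$\mathcal{S}^{I}=\Big\{(t_1,\dots,t_{n-1},t_x):\ t_x\le 0,\ \ \sum_{j=k}^{n-1}t_j+t_x\ \ge 0\ \text{ for all } n-I+1\le k\le n-1,\ \ 0\le \sum_{j=n-I}^{n-1}t_j\le -t_x\Big\}.$$ Then $$\mathcal{M}^{\mathrm{tf}}_{1,n}=\bigcup_{I=1}^{n-1}\mathcal{S}^{I}.$$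
   Context: Matrices. For a variable $y$ put $$M_L(y)=\begin{pmatrix} y & y\\ 0 & 1\end{pmatrix},\qquad M_R(y)=\begin{pmatrix} y & 0\\ 1 & 1\end{pmatrix}.$$ Reference fat graph and words. The reference fat graph is the planar one-loop tadpole graph with $n$ external legs: external legs $1$ and $2$ meet the internal edge $E_1$ at a cubic vertex; for $2\le k\le n-1$ the internal edges $E_{k-1}$ and $E_k$ and the external leg $k+1$ meet at a cubic vertex; and $E_{n-1}$ is attached to the loop edge $X$. A curve on the fat graph is recorded as a word listing the edges traversed, separated by the left ($L$) or right ($R$) turn taken at each vertex. The tadpole curve $C_{ii}$ starts at external leg $i$, goes once around the loop, and returns to leg $i$. Its word is: - for $i=1$: $\ 1\,L\,E_1\,L\,E_2\,L\cdots L\,E_{n-1}\,R\,X\,R\,E_{n-1}\,R\,E_{n-2}\,R\cdots R\,E_1\,R\,1$; - for $2\le i\le n$: $\ i\,R\,E_{i-1}\,L\,E_i\,L\cdots L\,E_{n-1}\,R\,X\,R\,E_{n-1}\,R\,E_{n-2}\,R\cdots R\,E_{i-1}\,L\,i$ (for $i=n$ this is $n\,R\,E_{n-1}\,R\,X\,R\,E_{n-1}\,L\,n$). Matrix of a curve. Associate the variable $y_k$ to $E_k$, the variable $x$ to $X$, and the value $1$ to external legs. The matrix $M_C$ of a curve $C$ is the product, from left to right along the word, of one factor $M_L(\cdot)$ or $M_R(\cdot)$ for each turn, evaluated at the variable of the edge immediately preceding that turn. For example, for $n=2$: $M_{C_{11}}=M_L(1)M_R(y_1)M_R(x)M_R(y_1)$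 and $M_{C_{22}}=M_R(1)M_R(y_1)M_R(x)M_L(y_1)$. The entries are polynomials in $y_1,\dots,y_{n-1},x$ with nonnegative coefficients. Tropicalization and headlight functions. For a nonzero polynomial $f=\sum_m c_m\, y_1^{m_1}\cdots y_{n-1}^{m_{n-1}}x^{m_x}$ with nonnegative coefficients, $\mathrm{Trop}\,f(t_1,\dots,t_{n-1},t_x)=\max_{m:\,c_m\neq 0}\big(m_1t_1+\cdots+m_{n-1}t_{n-1}+m_xt_x\big)$. The headlight function of $C_{ii}$ is $$\alpha_{ii}=\mathrm{Trop}\,(M_{C_{ii}})_{11}+\mathrm{Trop}\,(M_{C_{ii}})_{22}-\mathrm{Trop}\,(M_{C_{ii}})_{12}-\mathrm{Trop}\,(M_{C_{ii}})_{21}.$$ *)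

theory Defs
  imports "HOL-Analysis.Analysis" "HOL-Library.Poly_Mapping"
begin

text \<open>The variables are \<open>y\<^sub>k\<close>, written \<open>Y k\<close>, and \<open>x\<close>, written \<open>X\<close>. A monomial maps variables to
  exponents, a polynomial maps monomials to coefficients; both have finite support, and
  multiplication of polynomials is convolution. Real coefficients contain the integer coefficients
  that actually occur.\<close>

datatype var = Y nat | X

type_synonym monomial = "var \<Rightarrow>\<^sub>0 nat"

type_synonym mpoly = "monomial \<Rightarrow>\<^sub>0 real"

definition Var :: "var \<Rightarrow> mpoly" where
  "Var v = Poly_Mapping.single (Poly_Mapping.single v 1) 1"

text \<open>The value at a point \<open>t\<close> of the linear form attached to a monomial; \<open>keys m\<close> is the finite
  set of variables that occur in \<open>m\<close>.\<close>

definition monomial_form :: "monomial \<Rightarrow> (var \<Rightarrow> real) \<Rightarrow> real" where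
  "monomial_form m t = (\<Sum>v\<in>Poly_Mapping.keys m. real (Poly_Mapping.lookup m v) * t v)"

text \<open>\<open>keys f\<close> is the finite set of monomials with nonzero coefficient. It is empty for \<open>f = 0\<close>, where
  the value of \<open>Trop\<close> is meaningless; the polynomials used below are nonzero with nonnegative
  coefficients.\<close>

definition Trop :: "mpoly \<Rightarrow> (var \<Rightarrow> real) \<Rightarrow> real" where
  "Trop f t = Max ((\<lambda>m. monomial_form m t) ` Poly_Mapping.keys f)"

datatype edge = Leg nat | Internal nat | Loop

datatype turn = L | R

text \<open>A word \<open>e\<^sub>1 \<tau>\<^sub>1 e\<^sub>2 \<tau>\<^sub>2 \<dots> e\<^sub>r \<tau>\<^sub>r e\<close> is stored as the list of the pairs \<open>(e\<^sub>j, \<tau>\<^sub>j)\<close>, an edge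
  and the turn taken right after it, together with its last edge \<open>e\<close>.\<close>

type_synonym curve = "(edge \<times> turn) list \<times> edge"

text \<open>\<open>Internal k\<close> is \<open>E\<^sub>k\<close> and \<open>Loop\<close> is the loop edge \<open>X\<close>. The lists \<open>[a..<b]\<close> exclude \<open>b\<close>, so the
  outgoing part turns left after \<open>E\<^sub>1, \<dots>, E\<^sub>n\<^sub>-\<^sub>2\<close> (resp. \<open>E\<^sub>i\<^sub>-\<^sub>1, \<dots>, E\<^sub>n\<^sub>-\<^sub>2\<close>), and the returning part
  turns right after \<open>E\<^sub>n\<^sub>-\<^sub>1, \<dots>, E\<^sub>1\<close> (resp. \<open>E\<^sub>n\<^sub>-\<^sub>1, \<dots>, E\<^sub>i\<close>, followed by a left turn after
  \<open>E\<^sub>i\<^sub>-\<^sub>1\<close>). Meant for \<open>n \<ge> 2\<close> and \<open>1 \<le> i \<le> n\<close>.\<close>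

definition tadpole_curve :: "nat \<Rightarrow> nat \<Rightarrow> curve" where
  "tadpole_curve n i =
    (if i = 1 then
       ([(Leg 1, L)] @ map (\<lambda>k. (Internal k, L)) [1..<n - 1]
         @ [(Internal (n - 1), R), (Loop, R)]
         @ map (\<lambda>k. (Internal k, R)) (rev [1..<n]),
        Leg 1)
     else
       ([(Leg i, R)] @ map (\<lambda>k. (Internal k, L)) [i - 1..<n - 1]
         @ [(Internal (n - 1), R), (Loop, R)]
         @ map (\<lambda>k. (Internal k, R)) (rev [i..<n]) @ [(Internal (i - 1), L)],
        Leg i))"

fun edge_weight :: "edge \<Rightarrow> mpoly" where
  "edge_weight (Leg k) = 1"
| "edge_weight (Internal k) = Var (Y k)"
| "edge_weight Loop = Var X"

fun turn_matrix :: "turn \<Rightarrow> mpoly \<Rightarrow> mpoly ^ 2 ^ 2" where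
  "turn_matrix L y = vector [vector [y, y], vector [0, 1]]"
| "turn_matrix R y = vector [vector [y, 0], vector [1, 1]]"

fun steps_matrix :: "(edge \<times> turn) list \<Rightarrow> mpoly ^ 2 ^ 2" where
  "steps_matrix [] = mat 1"
| "steps_matrix ((e, \<tau>) # w) = turn_matrix \<tau> (edge_weight e) ** steps_matrix w"

text \<open>The last edge of a curve is not followed by a turn and contributes no factor.\<close>

definition curve_matrix :: "curve \<Rightarrow> mpoly ^ 2 ^ 2" where
  "curve_matrix C = steps_matrix (fst C)"

definition headlight :: "curve \<Rightarrow> (var \<Rightarrow> real) \<Rightarrow> real" where
  "headlight C t =
    Trop (curve_matrix C $ 1 $ 1) t + Trop (curve_matrix C $ 2 $ 2) t
    - Trop (curve_matrix C $ 1 $ 2) t - Trop (curve_matrix C $ 2 $ 1) t"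

text \<open>\<open>\<real>\<^sup>n\<close> with coordinates \<open>t (Y 1), \<dots>, t (Y (n - 1)), t X\<close>, as the functions that are
  \<open>undefined\<close> off these \<open>n\<close> indices, so that a point is determined by its coordinates.\<close>

definition coord_space :: "nat \<Rightarrow> (var \<Rightarrow> real) set" where
  "coord_space n = (\<Pi>\<^sub>E v\<in>insert X (Y ` {1..n - 1}). UNIV)"

definition tadpole_free :: "nat \<Rightarrow> (var \<Rightarrow> real) set" where
  "tadpole_free n =
    {t \<in> coord_space n. t X \<le> 0 \<and> (\<forall>i\<in>{1..n}. headlight (tadpole_curve n i) t = 0)}"

definition region :: "nat \<Rightarrow> nat \<Rightarrow> (var \<Rightarrow> real) set" where
  "region n I =
    {t \<in> coord_space n. t X \<le> 0
      \<and> (\<forall>k\<in>{n - I + 1..n - 1}. (\<Sum>j=k..n - 1. t (Y j)) + t X \<ge> 0)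
      \<and> 0 \<le> (\<Sum>j=n - I..n - 1. t (Y j)) \<and> (\<Sum>j=n - I..n - 1. t (Y j)) \<le> - t X}"

end

theory Submission
  imports Defs
begin

text \<open>On nonzero polynomials with nonnegative coefficients \<open>Trop\<close> turns products into sums and sums into
  maxima. Let \<open>D = y\<^sub>a\<^sub>+\<^sub>1 \<cdots> y\<^sub>n\<^sub>-\<^sub>1\<close> and \<open>G = 1 + y\<^sub>a\<^sub>+\<^sub>1 + \<dots> + y\<^sub>a\<^sub>+\<^sub>1 \<cdots> y\<^sub>n\<^sub>-\<^sub>2\<close>. The upper left entry of the
  part of the curve matrix around the loop factors as \<open>y\<^sub>a (x D + G) (D + G)\<close>, so that every headlight
  function is an explicit expression in the tail sums \<open>s\<^sub>k = t\<^sub>k + \<dots> + t\<^sub>n\<^sub>-\<^sub>1\<close> and the minimum of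
  \<open>s\<^sub>k\<close> over \<open>k > a\<close>. For \<open>t\<^sub>x \<le> 0\<close> it follows that \<open>\<alpha>\<^sub>1\<^sub>1 = 0\<close> iff some \<open>s\<^sub>k \<le> - t\<^sub>x\<close>, and
  that, for \<open>1 \<le> a < n\<close>, the next curve, \<open>i = a + 1\<close>, has \<open>\<alpha>\<^sub>i\<^sub>i = 0\<close> iff \<open>s\<^sub>a \<ge> 0\<close> or some \<open>s\<^sub>k \<le> - t\<^sub>x\<close>
  with \<open>k > a\<close>. A point where all of them vanish lies in the region whose index \<open>n - I\<close> is the
  largest \<open>k\<close> with \<open>s\<^sub>k \<le> - t\<^sub>x\<close>.\<close>

section \<open>Tropicalization of polynomials with nonnegative coefficients\<close>

definition positive_poly :: "mpoly \<Rightarrow> bool" where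
  "positive_poly f \<longleftrightarrow> f \<noteq> 0 \<and> (\<forall>m. 0 \<le> Poly_Mapping.lookup f m)"

lemma monomial_form_superset:
  assumes "finite A" "Poly_Mapping.keys m \<subseteq> A"
  shows "monomial_form m t = (\<Sum>v\<in>A. real (Poly_Mapping.lookup m v) * t v)"
  unfolding monomial_form_def using assms
  by (intro sum.mono_neutral_left) (auto simp: in_keys_iff)

lemma monomial_form_add: "monomial_form (a + b) t = monomial_form a t + monomial_form b t"
proof -
  let ?A = "Poly_Mapping.keys a \<union> Poly_Mapping.keys b"
  have "Poly_Mapping.keys (a + b) \<subseteq> ?A"
    by (rule Poly_Mapping.keys_add)
  then show ?thesis
    by (simp add: monomial_form_superset[of ?A] lookup_add algebra_simps sum.distrib)
qed

text \<open>Nonnegative coefficients cannot cancel; this is the purpose of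
  \<open>positive_poly\<close>.\<close>

lemma keys_add_positive:
  assumes "positive_poly f" "positive_poly g"
  shows "Poly_Mapping.keys (f + g) = Poly_Mapping.keys f \<union> Poly_Mapping.keys g"
  using assms by (auto simp: positive_poly_def in_keys_iff lookup_add add_nonneg_eq_0_iff)

text \<open>Convolution as a finite sum over pairs of keys, to which termwise sign arguments
  apply.\<close>

lemma lookup_times_sum:
  fixes f g :: mpoly
  shows "Poly_Mapping.lookup (f * g) m =
    (\<Sum>(a, b)\<in>Poly_Mapping.keys f \<times> Poly_Mapping.keys g.
      if m = a + b then Poly_Mapping.lookup f a * Poly_Mapping.lookup g b else 0)"
proof -
  have "Poly_Mapping.lookup (f * g) m =
      (\<Sum>(a, b). Poly_Mapping.lookup f a * Poly_Mapping.lookup g b when m = a + b)"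
    by (simp add: times_poly_mapping.rep_eq prod_fun_unfold_prod)
  also have "\<dots> = (\<Sum>(a, b)\<in>Poly_Mapping.keys f \<times> Poly_Mapping.keys g.
      Poly_Mapping.lookup f a * Poly_Mapping.lookup g b when m = a + b)"
    by (rule Sum_any.expand_superset) (auto simp: in_keys_iff when_def split: if_splits)
  finally show ?thesis
    by (simp add: when_def)
qed

lemma lookup_times_nonneg:
  assumes "positive_poly f" "positive_poly g"
  shows "0 \<le> Poly_Mapping.lookup (f * g) m"
  unfolding lookup_times_sum using assms
  by (intro sum_nonneg) (auto simp: positive_poly_def)

text \<open>The support of the product is the full Minkowski sum of the supports: the pair
  \<open>(a, b)\<close> contributes a positive term to the coefficient of \<open>a + b\<close>, and
  no term is negative.\<close>

lemma keys_times_positive: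
  assumes "positive_poly f" "positive_poly g"
  shows "Poly_Mapping.keys (f * g) =
    {a + b |a b. a \<in> Poly_Mapping.keys f \<and> b \<in> Poly_Mapping.keys g}"
proof
  show "Poly_Mapping.keys (f * g) \<subseteq>
      {a + b |a b. a \<in> Poly_Mapping.keys f \<and> b \<in> Poly_Mapping.keys g}"
    by (rule keys_mult)
next
  have "Poly_Mapping.lookup (f * g) (a + b) \<noteq> 0"
    if "a \<in> Poly_Mapping.keys f" "b \<in> Poly_Mapping.keys g" for a b
  proof -
    have nn: "0 \<le> Poly_Mapping.lookup f u" "0 \<le> Poly_Mapping.lookup g u" for u
      using assms by (auto simp: positive_poly_def)
    have "0 < Poly_Mapping.lookup f a * Poly_Mapping.lookup g b"
      using that nn[of a] nn[of b] by (simp add: in_keys_iff less_le)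
    then have "0 < Poly_Mapping.lookup (f * g) (a + b)"
      unfolding lookup_times_sum using that nn
      by (intro sum_pos2[where i = "(a, b)"]) auto
    then show ?thesis
      by simp
  qed
  then show "{a + b |a b. a \<in> Poly_Mapping.keys f \<and> b \<in> Poly_Mapping.keys g}
      \<subseteq> Poly_Mapping.keys (f * g)"
    by (auto simp: in_keys_iff)
qed

lemma positive_poly_keys: "positive_poly f \<Longrightarrow> Poly_Mapping.keys f \<noteq> {}"
  by (simp add: positive_poly_def)

lemma positive_poly_one [simp]: "positive_poly 1"
  by (auto simp: positive_poly_def lookup_one when_def)

lemma positive_poly_Var [simp]: "positive_poly (Var v)"
proof -
  have "Poly_Mapping.keys (Var v) \<noteq> {}"
    by (simp add: Var_def)
  then have "Var v \<noteq> 0"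
    by force
  then show ?thesis
    by (simp add: positive_poly_def) (simp add: Var_def lookup_single when_def)
qed

lemma positive_poly_add [simp]:
  assumes "positive_poly f" "positive_poly g"
  shows "positive_poly (f + g)"
proof -
  have "Poly_Mapping.keys (f + g) \<noteq> {}"
    using assms positive_poly_keys by (simp add: keys_add_positive del: keys_eq_empty)
  then show ?thesis
    using assms by (auto simp: positive_poly_def lookup_add)
qed

lemma positive_poly_times [simp]:
  assumes "positive_poly f" "positive_poly g"
  shows "positive_poly (f * g)"
proof -
  have "Poly_Mapping.keys (f * g) \<noteq> {}"
    using positive_poly_keys[OF assms(1)] positive_poly_keys[OF assms(2)]
    by (auto simp: keys_times_positive[OF assms] simp del: keys_eq_empty)
  then show ?thesis
    using lookup_times_nonneg[OF assms] unfolding positive_poly_def by auto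
qed

lemma Trop_one [simp]: "Trop 1 t = 0"
  by (simp add: Trop_def monomial_form_def)

lemma Trop_Var [simp]: "Trop (Var v) t = t v"
  by (simp add: Trop_def Var_def monomial_form_def)

lemma Trop_add [simp]:
  assumes "positive_poly f" "positive_poly g"
  shows "Trop (f + g) t = max (Trop f t) (Trop g t)"
  using assms positive_poly_keys
  by (simp add: Trop_def keys_add_positive image_Un Max_Un del: keys_eq_empty)

lemma Trop_times [simp]:
  assumes "positive_poly f" "positive_poly g"
  shows "Trop (f * g) t = Trop f t + Trop g t"
proof -
  let ?F = "(\<lambda>m. monomial_form m t) ` Poly_Mapping.keys f"
  let ?G = "(\<lambda>m. monomial_form m t) ` Poly_Mapping.keys g"
  let ?FG = "(\<lambda>m. monomial_form m t) ` Poly_Mapping.keys (f * g)"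
  \<comment> \<open>Since \<open>monomial_form\<close> is additive, the values on the product form a
    Minkowski sum, whose maximum is the sum of the two maxima.\<close>
  have FG: "?FG = {u + v |u v. u \<in> ?F \<and> v \<in> ?G}"
    unfolding keys_times_positive[OF assms] by (force simp: monomial_form_add image_iff)
  have "?F \<noteq> {}" "?G \<noteq> {}"
    using assms by (auto dest: positive_poly_keys simp del: keys_eq_empty)
  then have "Max ?F \<in> ?F" "Max ?G \<in> ?G"
    by (auto intro!: Max_in simp del: image_is_empty)
  moreover have "finite ?FG"
    by simp
  ultimately show ?thesis
    unfolding Trop_def
    by (intro Max_eqI) (auto simp only: FG intro!: add_mono Max_ge finite_imageI finite_keys)
qed

lemma positive_poly_prod [simp]:
  "(\<And>i. i \<in> A \<Longrightarrow> positive_poly (f i)) \<Longrightarrow> positive_poly (prod f A)"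
  by (induction A rule: infinite_finite_induct) auto

lemma Trop_prod [simp]:
  "(\<And>i. i \<in> A \<Longrightarrow> positive_poly (f i)) \<Longrightarrow> Trop (prod f A) t = (\<Sum>i\<in>A. Trop (f i) t)"
  by (induction A rule: infinite_finite_induct) auto

lemma positive_poly_sum [simp]:
  "\<lbrakk>finite A; A \<noteq> {}; \<And>i. i \<in> A \<Longrightarrow> positive_poly (f i)\<rbrakk> \<Longrightarrow> positive_poly (sum f A)"
  by (induction A rule: finite_ne_induct) auto

lemma Trop_sum:
  "\<lbrakk>finite A; A \<noteq> {}; \<And>i. i \<in> A \<Longrightarrow> positive_poly (f i)\<rbrakk>
    \<Longrightarrow> Trop (sum f A) t = Max ((\<lambda>i. Trop (f i) t) ` A)"
  by (induction A rule: finite_ne_induct) auto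

section \<open>Matrices of the tadpole curves\<close>

abbreviation mat2 :: "'a \<Rightarrow> 'a \<Rightarrow> 'a \<Rightarrow> 'a \<Rightarrow> ('a::zero) ^ 2 ^ 2" where
  "mat2 a b c d \<equiv> vector [vector [a, b], vector [c, d]]"

lemma mat2_mult:
  "mat2 a b c d ** mat2 a' b' c' (d' :: 'a :: semiring_1) =
    mat2 (a * a' + b * c') (a * b' + b * d') (c * a' + d * c') (c * b' + d * d')"
  by (simp add: matrix_matrix_mult_def vec_eq_iff forall_2 sum_2)

lemma mat2_one: "mat 1 = (mat2 1 0 0 1 :: ('a :: semiring_1) ^ 2 ^ 2)"
  by (simp add: mat_def vec_eq_iff forall_2)

lemma steps_matrix_append: "steps_matrix (v @ w) = steps_matrix v ** steps_matrix w"
  by (induction v rule: steps_matrix.induct) (auto simp: matrix_mul_assoc)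

definition path_prod :: "nat \<Rightarrow> nat \<Rightarrow> mpoly" where
  "path_prod a b = (\<Prod>k\<in>{a..<b}. Var (Y k))"

text \<open>The sum starts with the empty product 1 and omits the full product
  \<open>path_prod a b\<close>; for \<open>b \<le> a\<close> it is 0. The \<open>G\<close> of the
  overview is \<open>path_sum (Suc a) n\<close>.\<close>

definition path_sum :: "nat \<Rightarrow> nat \<Rightarrow> mpoly" where
  "path_sum a b = (\<Sum>j\<in>{a..<b}. path_prod a j)"

lemma path_prod_Suc: "a \<le> b \<Longrightarrow> path_prod a (Suc b) = path_prod a b * Var (Y b)"
  by (simp add: path_prod_def)

lemma path_prod_head: "a < b \<Longrightarrow> path_prod a b = Var (Y a) * path_prod (Suc a) b"
  by (simp add: path_prod_def prod.atLeast_Suc_lessThan)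

lemma path_sum_head: "a < b \<Longrightarrow> path_sum a b = 1 + Var (Y a) * path_sum (Suc a) b"
  by (simp add: path_sum_def path_prod_head sum.atLeast_Suc_lessThan sum_distrib_left)
    (simp add: path_prod_def)

text \<open>Reversal puts the largest edge first, so the induction step multiplies on the left by a
  right-turn matrix, which adds the old product to the lower left entry.\<close>

lemma steps_matrix_right:
  "a \<le> b \<Longrightarrow> steps_matrix (map (\<lambda>k. (Internal k, R)) (rev [a..<b])) =
    mat2 (path_prod a b) 0 (path_sum a b) 1"
proof (induction b rule: dec_induct)
  case base
  then show ?case
    by (simp add: path_prod_def path_sum_def mat2_one)
next
  case (step b)
  then show ?case
    by (simp add: mat2_mult path_prod_Suc path_sum_def algebra_simps)
qed

text \<open>Here the new factor stands on the right. The upper right entry lacks the constant term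
  1, hence the \<open>- 1\<close>; it is eliminated in the curve matrices below, since positivity
  does not survive subtraction.\<close>

lemma steps_matrix_left:
  "a \<le> b \<Longrightarrow> steps_matrix (map (\<lambda>k. (Internal k, L)) [a..<b]) =
    mat2 (path_prod a b) (path_sum a (Suc b) - 1) 0 1"
proof (induction b rule: dec_induct)
  case base
  then show ?case
    by (simp add: path_prod_def path_sum_def mat2_one)
next
  case (step b)
  then show ?case
    by (simp add: steps_matrix_append mat2_mult path_prod_Suc path_sum_def mat2_one algebra_simps)
qed

text \<open>The factor of the initial left turn adds 1 to \<open>G - 1\<close>. The upper left entry
  arises as \<open>D * X * D + G * ((X + 1) * D + G)\<close> and is factored so that its
  tropicalization is a sum of two maxima.\<close>

lemma curve_matrix_first:
  assumes "n \<ge> 2"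
  defines "D \<equiv> path_prod 1 n" and "G \<equiv> path_sum 1 n"
  shows "curve_matrix (tadpole_curve n 1) =
    mat2 ((Var X * D + G) * (D + G)) G ((Var X + 1) * D + G) 1"
proof -
  from assms(1) obtain m where n: "n = Suc m" and m: "1 \<le> m"
    by (cases n) auto
  have D: "D = path_prod 1 m * Var (Y m)"
    using m by (simp add: D_def n path_prod_Suc)
  have "curve_matrix (tadpole_curve n 1) =
      mat2 1 1 0 1 ** (mat2 (path_prod 1 m) (G - 1) 0 1 **
        (mat2 (Var (Y m)) 0 1 1 ** (mat2 (Var X) 0 1 1 ** mat2 D 0 G 1)))"
    using m steps_matrix_left[of 1 m] steps_matrix_right[of 1 n]
    by (simp add: curve_matrix_def tadpole_curve_def steps_matrix_append n G_def D_def
        del: upt_Suc rev_map)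
  also have "\<dots> = mat2 ((Var X * D + G) * (D + G)) G ((Var X + 1) * D + G) 1"
    by (simp add: mat2_mult D algebra_simps)
  finally show ?thesis .
qed

lemma curve_matrix_later:
  assumes "1 \<le> a" "a < n"
  defines "D \<equiv> path_prod (Suc a) n" and "G \<equiv> path_sum (Suc a) n" and "y \<equiv> Var (Y a)"
  defines "p \<equiv> y * ((Var X * D + G) * (D + G))" and "r \<equiv> (Var X + 1) * D + G"
  shows "curve_matrix (tadpole_curve n (Suc a)) =
    mat2 (p * y) (p * y + y * G) ((p + r) * y) ((p + r) * y + (y * G + 1))"
proof -
  from assms(1,2) obtain m where n: "n = Suc m" and m: "a \<le> m"
    by (cases n) auto
  \<comment> \<open>The product over \<open>{a..<n}\<close> is split once at its last and once at
    its first factor.\<close>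
  have A: "path_prod a m * Var (Y m) = y * D"
    using m path_prod_Suc[of a m] path_prod_head[of a n] by (simp add: D_def n y_def)
  have F: "path_sum a (Suc m) - 1 = y * G"
    using m path_sum_head[of a n] by (simp add: G_def n y_def)
  have "curve_matrix (tadpole_curve n (Suc a)) =
      mat2 1 0 1 1 ** (mat2 (path_prod a m) (y * G) 0 1 **
        (mat2 (Var (Y m)) 0 1 1 ** (mat2 (Var X) 0 1 1 ** (mat2 D 0 G 1 ** mat2 y y 0 1))))"
    using m steps_matrix_left[of a m] steps_matrix_right[of "Suc a" n] assms(1)
    by (simp add: curve_matrix_def tadpole_curve_def steps_matrix_append n F G_def D_def y_def
        del: upt_Suc rev_map)
  also have "\<dots> = mat2 1 0 1 1 ** (mat2 p (y * G) r 1 ** mat2 y y 0 1)"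
  proof -
    have "mat2 (path_prod a m) (y * G) 0 1 ** (mat2 (Var (Y m)) 0 1 1 ** (mat2 (Var X) 0 1 1 ** mat2 D 0 G 1))
      = mat2 ((path_prod a m * Var (Y m)) * Var X * D + y * G * ((Var X + 1) * D + G)) (y * G) r 1"
      by (simp add: mat2_mult r_def algebra_simps)
    also have "\<dots> = mat2 p (y * G) r 1"
      unfolding A p_def by (simp add: algebra_simps)
    finally show ?thesis
      by (simp add: matrix_mul_assoc)
  qed
  also have "\<dots> = mat2 (p * y) (p * y + y * G) ((p + r) * y) ((p + r) * y + (y * G + 1))"
    by (simp add: mat2_mult algebra_simps)
  finally show ?thesis .
qed

section \<open>Vanishing of the headlight functions\<close>

definition tail_sum :: "nat \<Rightarrow> (var \<Rightarrow> real) \<Rightarrow> nat \<Rightarrow> real" where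
  "tail_sum n t k = (\<Sum>j\<in>{k..<n}. t (Y j))"

lemma positive_path_prod [simp]: "positive_poly (path_prod a b)"
  by (simp add: path_prod_def)

lemma Trop_path_prod [simp]: "Trop (path_prod a b) t = tail_sum b t a"
  by (simp add: path_prod_def tail_sum_def)

lemma positive_path_sum [simp]: "a < b \<Longrightarrow> positive_poly (path_sum a b)"
  by (simp add: path_sum_def)

text \<open>The monomial \<open>path_prod a j\<close> tropicalizes to
  \<open>tail_sum n t a - tail_sum n t j\<close>, so the maximum is attained where the tail sum is
  smallest.\<close>

lemma Trop_path_sum:
  assumes "a < n"
  obtains k where "k \<in> {a..<n}" "Trop (path_sum a n) t = tail_sum n t a - tail_sum n t k"
    "\<And>j. j \<in> {a..<n} \<Longrightarrow> tail_sum n t k \<le> tail_sum n t j"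
proof -
  have split: "tail_sum j t a = tail_sum n t a - tail_sum n t j" if "j \<in> {a..<n}" for j
    using that sum.atLeastLessThan_concat[of a j n "\<lambda>j. t (Y j)"] by (simp add: tail_sum_def)
  obtain k where k: "k \<in> {a..<n}" "\<And>j. j \<in> {a..<n} \<Longrightarrow> tail_sum n t k \<le> tail_sum n t j"
    using ex_is_arg_min_if_finite[of "{a..<n}" "tail_sum n t"] assms
    by (auto simp: is_arg_min_linorder)
  have "Trop (path_sum a n) t = Max ((\<lambda>j. tail_sum j t a) ` {a..<n})"
    using assms by (simp add: path_sum_def Trop_sum)
  also have "\<dots> = tail_sum n t a - tail_sum n t k"
    using k split by (intro Max_eqI) (auto intro!: image_eqI[where x = k])
  finally show ?thesis
    using that k by blast
qed

text \<open>With \<open>k\<close> minimizing the tail sum, the headlight function simplifies to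
  \<open>max 0 (tail_sum n t k + t X)\<close>.\<close>

lemma headlight_first_eq_0_iff:
  assumes "n \<ge> 2" "t X \<le> 0"
  shows "headlight (tadpole_curve n 1) t = 0 \<longleftrightarrow> (\<exists>k\<in>{1..<n}. tail_sum n t k \<le> - t X)"
proof -
  obtain k where k: "k \<in> {1..<n}" "Trop (path_sum 1 n) t = tail_sum n t 1 - tail_sum n t k"
    "\<And>j. j \<in> {1..<n} \<Longrightarrow> tail_sum n t k \<le> tail_sum n t j"
    using Trop_path_sum[of 1 n t] assms(1) by auto
  have ex: "(\<exists>k\<in>{1..<n}. tail_sum n t k \<le> - t X) \<longleftrightarrow> tail_sum n t k \<le> - t X"
    using k by force
  show ?thesis
    unfolding ex headlight_def curve_matrix_first[OF assms(1)] using assms k(2)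
    by (simp add: max_def)
qed

text \<open>With \<open>k > a\<close> minimizing the tail sum, the headlight function equals
  \<open>max 0 (min (- tail_sum n t a) (tail_sum n t k + t X))\<close>. For \<open>Suc a = n\<close>
  there is no such \<open>k\<close> and it equals \<open>max 0 (- t (Y a))\<close>.\<close>

lemma headlight_later_eq_0_iff:
  assumes "1 \<le> a" "a < n" "t X \<le> 0"
  shows "headlight (tadpole_curve n (Suc a)) t = 0 \<longleftrightarrow>
    0 \<le> tail_sum n t a \<or> (\<exists>k\<in>{Suc a..<n}. tail_sum n t k \<le> - t X)"
proof (cases "Suc a = n")
  case True
  \<comment> \<open>Now \<open>G = 0\<close> is not a positive polynomial, so it must vanish from
    the entries before \<open>Trop\<close> is evaluated.\<close>
  then have "path_prod (Suc a) n = 1" "path_sum (Suc a) n = 0" "tail_sum n t a = t (Y a)"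
    by (auto simp: path_prod_def path_sum_def tail_sum_def)
  then show ?thesis
    unfolding headlight_def curve_matrix_later[OF assms(1,2)] using assms True
    by (simp add: max_def)
next
  case False
  then have a: "Suc a < n"
    using assms by simp
  obtain k where k: "k \<in> {Suc a..<n}"
    "Trop (path_sum (Suc a) n) t = tail_sum n t (Suc a) - tail_sum n t k"
    "\<And>j. j \<in> {Suc a..<n} \<Longrightarrow> tail_sum n t k \<le> tail_sum n t j"
    using Trop_path_sum[of "Suc a" n t] a by auto
  have ex: "(\<exists>k\<in>{Suc a..<n}. tail_sum n t k \<le> - t X) \<longleftrightarrow> tail_sum n t k \<le> - t X"
    using k by force
  have "tail_sum n t a = t (Y a) + tail_sum n t (Suc a)"
    using assms by (simp add: tail_sum_def sum.atLeast_Suc_lessThan)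
  then show ?thesis
    unfolding ex headlight_def curve_matrix_later[OF assms(1,2)] using assms a k(2)
    by (simp add: max_def) arith
qed

section \<open>Comparison of the tadpole-free set with the regions\<close>

lemma tadpole_free_iff:
  assumes "n \<ge> 2"
  shows "t \<in> tadpole_free n \<longleftrightarrow> t \<in> coord_space n \<and> t X \<le> 0
    \<and> (\<exists>k\<in>{1..<n}. tail_sum n t k \<le> - t X)
    \<and> (\<forall>a\<in>{1..<n}. 0 \<le> tail_sum n t a \<or> (\<exists>k\<in>{Suc a..<n}. tail_sum n t k \<le> - t X))"
proof -
  have "{1..n} = insert 1 (Suc ` {1..<n})"
    using assms by (auto simp: image_Suc_atLeastLessThan)
  then have "(\<forall>i\<in>{1..n}. headlight (tadpole_curve n i) t = 0) \<longleftrightarrow>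
      headlight (tadpole_curve n 1) t = 0 \<and> (\<forall>a\<in>{1..<n}. headlight (tadpole_curve n (Suc a)) t = 0)"
    by (simp only: ball_simps)
  moreover have "(\<forall>a\<in>{1..<n}. headlight (tadpole_curve n (Suc a)) t = 0) \<longleftrightarrow>
      (\<forall>a\<in>{1..<n}. 0 \<le> tail_sum n t a \<or> (\<exists>k\<in>{Suc a..<n}. tail_sum n t k \<le> - t X))"
    if "t X \<le> 0"
    using that by (intro ball_cong refl headlight_later_eq_0_iff) auto
  ultimately show ?thesis
    unfolding tadpole_free_def mem_Collect_eq
    using headlight_first_eq_0_iff[OF assms, of t] by blast
qed

lemma region_iff:
  assumes "1 \<le> K" "K < n"
  shows "t \<in> region n (n - K) \<longleftrightarrow> t \<in> coord_space n \<and> t X \<le> 0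
    \<and> (\<forall>k\<in>{Suc K..<n}. - t X \<le> tail_sum n t k) \<and> 0 \<le> tail_sum n t K \<and> tail_sum n t K \<le> - t X"
proof -
  have "{k..n - 1} = {k..<n}" for k
    using assms by auto
  moreover have "n - (n - K) = K"
    using assms by simp
  ultimately show ?thesis
    unfolding region_def tail_sum_def by (auto simp: algebra_simps)
qed

theorem lemma6p1:
  fixes n :: nat
  assumes "n \<ge> 2"
  shows "tadpole_free n = (\<Union>I\<in>{1..n - 1}. region n I)"
proof -
  have "{1..n - 1} = (\<lambda>K. n - K) ` {1..<n}"
  proof (intro equalityI subsetI)
    fix I
    assume "I \<in> {1..n - 1}"
    then show "I \<in> (\<lambda>K. n - K) ` {1..<n}"
      by (intro image_eqI[where x = "n - I"]) auto
  qed auto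
  \<comment> \<open>Regions are indexed by \<open>K = n - I\<close>, the start of the tail sum
    bounded on both sides.\<close>
  then have U: "(\<Union>I\<in>{1..n - 1}. region n I) = (\<Union>K\<in>{1..<n}. region n (n - K))"
    by simp
  show ?thesis
    unfolding U
  proof (intro set_eqI iffI)
    fix t
    assume t: "t \<in> tadpole_free n"
    let ?S = "{k \<in> {1..<n}. tail_sum n t k \<le> - t X}"
    define K where "K = Max ?S"
    have "?S \<noteq> {}"
      using t assms by (auto simp: tadpole_free_iff)
    then have K: "K \<in> ?S"
      unfolding K_def by (intro Max_in) auto
    have later: "- t X < tail_sum n t k" if "k \<in> {Suc K..<n}" for k
    proof (rule ccontr)
      assume "\<not> - t X < tail_sum n t k"
      then have "k \<in> ?S"
        using that by auto
      then have "k \<le> K"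
        unfolding K_def by (intro Max_ge) auto
      then show False
        using that by simp
    qed
    \<comment> \<open>At \<open>a = K\<close> the second alternative of
      \<open>tadpole_free_iff\<close> contradicts the maximality of \<open>K\<close>.\<close>
    then have "0 \<le> tail_sum n t K"
      using t K assms by (fastforce simp: tadpole_free_iff)
    then have "t \<in> region n (n - K)"
      using t K assms later by (auto simp: region_iff tadpole_free_iff less_imp_le)
    then show "t \<in> (\<Union>K\<in>{1..<n}. region n (n - K))"
      using K by auto
  next
    fix t
    assume "t \<in> (\<Union>K\<in>{1..<n}. region n (n - K))"
    then obtain K where K: "K \<in> {1..<n}" and t: "t \<in> region n (n - K)"
      by auto
    then have t': "t \<in> coord_space n" "t X \<le> 0" "\<And>k. k \<in> {Suc K..<n} \<Longrightarrow> - t X \<le> tail_sum n t k"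
      "0 \<le> tail_sum n t K" "tail_sum n t K \<le> - t X"
      by (simp_all add: region_iff)
    \<comment> \<open>For \<open>a < K\<close> the witness is \<open>K\<close> itself; for
      \<open>a > K\<close> the tail sum is at least \<open>- t X\<close>, hence nonnegative.\<close>
    have "0 \<le> tail_sum n t a \<or> (\<exists>k\<in>{Suc a..<n}. tail_sum n t k \<le> - t X)"
      if "a \<in> {1..<n}" for a
    proof (cases a K rule: linorder_cases)
      case less
      then show ?thesis
        using t' K by auto
    next
      case equal
      then show ?thesis
        using t' by auto
    next
      case greater
      then have "- t X \<le> tail_sum n t a"
        using t' that by auto
      then show ?thesis
        using t' by auto
    qed
    then show "t \<in> tadpole_free n"
      using t' K assms by (auto simp: tadpole_free_iff)
  qed
qed

end
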